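(* Let $n=5$ and consider the extended $SL_5$ quiver with the $21$ variables $a_k,b_k,c_k,d_k,e_k$ $(1\le k\le4)$ and $a_t$ described in the context, subject to $$a_ta_1a_2^2a_3^2a_4^2\,b_1b_2b_3b_4\,c_1c_2c_3c_4\,d_1d_2d_3d_4\,e_1e_2e_3e_4=1 ,$$ and let $\mathbb A$ be the unipotent upper-triangular $5\times5$ matrix with entries $(-1)^{i+j}G_{i,j}$, $1\le i<j\le5$. Then the condition $$\det(\mathbb A+\mathbb A^{\mathrm T})=0$$ is preserved by all braid-group transformations, i.e. by those generated by the twists along $G_{i,i+1}$ and $\widetilde G_{i,i+1}$ $(1\le i\le4)$ and by the twist along $G_B$; that is, the condition is Hamiltonian.
   Context: Quiver arrows (each single unless stated): $a_2\to a_1$, $a_2\to a_3$, $a_3\to a_4$; $b_1\to b_2$, $b_2\to b_3$; $c_1\to c_2$, $c_2\to c_3$, $c_4\to c_3$; $d_1\to d_2$, $d_3\to d_2$, $d_4\to d_3$; $e_3\to e_2$, $e_4\to e_3$; $a_4\to b_4$, $b_4\to c_4$, $c_4\to d_4$, $d_4\to e_4$; $c_3\to d_3$, $d_3\to e_3$; $d_2\to e_2$; $e_1\to d_1$, $d_1\to c_1$, $c_1\to b_1$; $d_2\to c_2$, $c_2\to b_2$; $c_3\to b_3$; $e_2\to d_3$, $d_3\to c_4$, $e_3\to d_4$; $b_1\to a_2$, $b_2\to a_3$, $b_3\to a_4$; $b_2\to c_1$, $b_3\to c_2$, $c_2\to d_1$; $a_3\to b_1$, $a_4\to b_2$; $e_1\to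 b_3$, $b_4\to e_2$; $e_2\to a_4$, $e_4\to a_2$, $a_4\to e_1$, $a_3\to e_4$, $e_3\to a_3$, $a_4\to e_3$; $a_t\to a_2$, and a double arrow $a_1\Rightarrow a_t$. Poisson bracket: $\{x,y\}=\varepsilon_{xy}xy$, with $\varepsilon_{xy}$ the number of arrows $x\to y$ minus the number of arrows $y\to x$. Functions: $\langle x_1\cdots x_m\rangle:=(x_1\cdots x_m)^{1/2}\bigl(1+\frac1{x_1}+\frac1{x_1x_2}+\dots+\frac1{x_1\cdots x_m}\bigr)$. Then $G_B=\langle a_1a_t\rangle$, $G_{1,2}=\langle b_4e_2d_3c_4\rangle$, $G_{2,3}=\langle c_4c_3b_3a_4e_3d_4\rangle$, $G_{3,4}=\langle d_4d_3d_2c_2b_2a_3e_4\rangle$, and, with $w=e_4e_3e_2a_2a_3a_4$, $$G_{4,5}=(w\,e_1d_1c_1b_1a_2a_1)^{1/2}\Bigl[1+\tfrac1{e_4}+\tfrac1{e_4e_3}+\tfrac1{e_4e_3e_2}+\tfrac1{e_4a_2}+\tfrac1{e_4e_3a_2}+\tfrac1{e_4e_3e_2a_2}+\tfrac1{e_4e_3a_2a_3}+\tfrac1{e_4e_3e_2a_2a_3}+\tfrac1w+\tfrac1{we_1}+\tfrac1{we_1d_1}+\tfrac1{we_1d_1c_1}+\tfrac1{we_1d_1c_1b_1}+\tfrac1{we_1d_1c_1b_1a_2}+\tfrac1{we_1d_1c_1b_1a_2a_1}\Bigr].$$ For $l>k+1$: $G_{k,l}=\tfrac12G_{k,l-1}G_{l-1,l}+\{G_{k,l-1},G_{l-1,l}\}$.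 Braid-group transformations: the twist along $G_{i,i+1}$ acts by $\mathbb A\mapsto B_i\mathbb AB_i^{\mathrm T}$, where $B_i$ is the identity with the diagonal block in rows and columns $i,i+1$ replaced by $\begin{pmatrix}G_{i,i+1}&1\\-1&0\end{pmatrix}$ (or its inverse transformation). The twist along $\widetilde G_{i,i+1}$ (entries of the target matrix $\widetilde{\mathbb A}$, which Poisson commute with those of $\mathbb A$) leaves $\mathbb A$ unchanged and acts by the analogous congruence on $\widetilde{\mathbb A}$; one has $\det(\mathbb A+\mathbb A^{\mathrm T})=\det(\widetilde{\mathbb A}+\widetilde{\mathbb A}^{\mathrm T})$. The twist along $G_B$ fixes $G_{1,2},G_{2,3},G_{3,4}$ and maps $G_{4,5}$ to $\tfrac12G_BG_{4,5}+\{G_B,G_{4,5}\}$; on the entries of $\mathbb A$ it is realized by the substitution $a_1\mapsto 1/a_t$, $a_2\mapsto a_2(1+a_t)$ with the variables $a_3,a_4,b_k,c_k,d_k,e_k$ unchanged, where $a_t$ is expressed through the other variables by the constraint in the claim. "The condition is preserved" means that the locus $\{\det(\mathbb A+\mathbb A^{\mathrm T})=0\}$ is mapped to itself. *)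

theory Defs
  imports "HOL-Analysis.Derivative" "Jordan_Normal_Form.Determinant"
begin

datatype vertex =
    A1 | A2 | A3 | A4
  | B1 | B2 | B3 | B4
  | C1 | C2 | C3 | C4
  | D1 | D2 | D3 | D4
  | E1 | E2 | E3 | E4
  | AT

lemma UNIV_vertex:
  "UNIV = {A1, A2, A3, A4, B1, B2, B3, B4, C1, C2, C3, C4, D1, D2, D3, D4, E1, E2, E3, E4, AT}"
  by (auto intro: vertex.exhaust)

instance vertex :: finite
  by standard (simp add: UNIV_vertex)

text \<open>The arrows of the quiver, listed with multiplicity.\<close>

definition arrows :: "(vertex \<times> vertex) list" where
  "arrows =
    [(A2, A1), (A2, A3), (A3, A4), (B1, B2), (B2, B3), (C1, C2), (C2, C3), (C4, C3),
     (D1, D2), (D3, D2), (D4, D3), (E3, E2), (E4, E3),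
     (A4, B4), (B4, C4), (C4, D4), (D4, E4), (C3, D3), (D3, E3), (D2, E2),
     (E1, D1), (D1, C1), (C1, B1), (D2, C2), (C2, B2), (C3, B3),
     (E2, D3), (D3, C4), (E3, D4), (B1, A2), (B2, A3), (B3, A4),
     (B2, C1), (B3, C2), (C2, D1), (A3, B1), (A4, B2), (E1, B3), (B4, E2),
     (E2, A4), (E4, A2), (A4, E1), (A3, E4), (E3, A3), (A4, E3),
     (AT, A2), (A1, AT), (A1, AT)]"

definition eps :: "vertex \<Rightarrow> vertex \<Rightarrow> int" where
  "eps x y = int (count_list arrows (x, y)) - int (count_list arrows (y, x))"

text \<open>
  A point assigns to every vertex \<open>x\<close> a nonzero complex number \<open>s x\<close>, the chosen square root
  of the quiver variable, whose value is therefore \<open>(s x)\<^sup>2\<close>; the square roots of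
  monomials occurring in the \<open>G\<close> are the corresponding products of the \<open>s x\<close>.
  Complex values are needed: \<open>det (\<A> + \<A>\<^sup>T)\<close> is a Laurent polynomial in the quiver variables
  with positive coefficients, so it has no zero at positive real values of the variables.
\<close>

type_synonym point = "vertex \<Rightarrow> complex"

definition var :: "vertex \<Rightarrow> point \<Rightarrow> complex" where
  "var x s = (s x)\<^sup>2"

definition phase_space :: "point set" where
  "phase_space = {s. (\<forall>x. s x \<noteq> 0) \<and>
     var AT s * var A1 s * (var A2 s)\<^sup>2 * (var A3 s)\<^sup>2 * (var A4 s)\<^sup>2 *
     (var B1 s * var B2 s * var B3 s * var B4 s) *
     (var C1 s * var C2 s * var C3 s * var C4 s) *
     (var D1 s * var D2 s * var D3 s * var D4 s) *
     (var E1 s * var E2 s * var E3 s * var E4 s) = 1}"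

text \<open>
  The partial derivative with respect to the quiver variable \<open>(s x)\<^sup>2\<close>, by the chain rule.
\<close>

definition partial :: "vertex \<Rightarrow> (point \<Rightarrow> complex) \<Rightarrow> point \<Rightarrow> complex" where
  "partial x f s = deriv (\<lambda>t. f (s(x := t))) (s x) / (2 * s x)"

definition poisson :: "(point \<Rightarrow> complex) \<Rightarrow> (point \<Rightarrow> complex) \<Rightarrow> point \<Rightarrow> complex" where
  "poisson f g s = (\<Sum>x\<in>UNIV. \<Sum>y\<in>UNIV.
     partial x f s * partial y g s * (of_int (eps x y) * var x s * var y s))"

definition monomial :: "vertex list \<Rightarrow> point \<Rightarrow> complex" where
  "monomial xs s = (\<Prod>x\<leftarrow>xs. var x s)"

definition sqrt_monomial :: "vertex list \<Rightarrow> point \<Rightarrow> complex" where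
  "sqrt_monomial xs s = (\<Prod>x\<leftarrow>xs. s x)"

definition angle :: "vertex list \<Rightarrow> point \<Rightarrow> complex" where
  "angle xs s = sqrt_monomial xs s * (\<Sum>m\<le>length xs. 1 / monomial (take m xs) s)"

definition G_B :: "point \<Rightarrow> complex" where
  "G_B = angle [A1, AT]"

definition G45 :: "point \<Rightarrow> complex" where
  "G45 s = (let w = [E4, E3, E2, A2, A3, A4] in
     sqrt_monomial (w @ [E1, D1, C1, B1, A2, A1]) s *
     (\<Sum>u\<leftarrow>[[], [E4], [E4, E3], [E4, E3, E2], [E4, A2], [E4, E3, A2], [E4, E3, E2, A2],
            [E4, E3, A2, A3], [E4, E3, E2, A2, A3], w, w @ [E1], w @ [E1, D1],
            w @ [E1, D1, C1], w @ [E1, D1, C1, B1], w @ [E1, D1, C1, B1, A2],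
            w @ [E1, D1, C1, B1, A2, A1]]. 1 / monomial u s))"

definition G_adj :: "nat \<Rightarrow> point \<Rightarrow> complex" where
  "G_adj k =
    (if k = 1 then angle [B4, E2, D3, C4]
     else if k = 2 then angle [C4, C3, B3, A4, E3, D4]
     else if k = 3 then angle [D4, D3, D2, C2, B2, A3, E4]
     else G45)"

text \<open>\<open>G k l\<close> is meaningful for \<open>1 \<le> k < l \<le> 5\<close> only.\<close>

fun G :: "nat \<Rightarrow> nat \<Rightarrow> point \<Rightarrow> complex" where
  "G k 0 = (\<lambda>s. 0)"
| "G k (Suc l) =
    (if l = k then G_adj k
     else (\<lambda>s. 1 / 2 * G k l s * G_adj l s + poisson (G k l) (G_adj l) s))"

text \<open>Matrix indices of the library start at 0, those of \<open>G\<close> at 1.\<close>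

definition Amat :: "point \<Rightarrow> complex mat" where
  "Amat s = mat 5 5 (\<lambda>(i, j).
     if i = j then 1 else if i < j then (-1) ^ (i + j) * G (i + 1) (j + 1) s else 0)"

definition degenerate_locus :: "point set" where
  "degenerate_locus = {s \<in> phase_space. Determinant.det (Amat s + transpose_mat (Amat s)) = 0}"

definition braid_factor :: "nat \<Rightarrow> complex \<Rightarrow> complex mat" where
  "braid_factor i g = mat 5 5 (\<lambda>(r, c).
     if (r, c) = (i - 1, i - 1) then g
     else if (r, c) = (i - 1, i) then 1
     else if (r, c) = (i, i - 1) then -1
     else if (r, c) = (i, i) then 0
     else if r = c then 1 else 0)"

text \<open>
  The transformations of the phase space are only partially defined (they are birational) and
  involve choices of square roots, so they are represented by relations. The action of a twist
  along \<open>G\<^sub>i\<^sub>,\<^sub>i\<^sub>+\<^sub>1\<close> is prescribed on \<open>\<A>\<close> only; \<open>twist i\<close> contains every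
  transformation of the phase space with this action.
\<close>

definition twist :: "nat \<Rightarrow> point rel" where
  "twist i = {(s, s'). s \<in> phase_space \<and> s' \<in> phase_space \<and>
     Amat s' = braid_factor i (G i (i + 1) s) * Amat s *
       transpose_mat (braid_factor i (G i (i + 1) s))}"

text \<open>
  What is known of the target matrix. Its entries are \<open>(-1)\<^sup>i\<^sup>+\<^sup>j\<close> times the \<open>G\<^sub>i\<^sub>,\<^sub>j\<close> of the
  target, so the latter is recovered as minus the entry above the diagonal when \<open>j = i + 1\<close>.
\<close>

definition target_matrix :: "(point \<Rightarrow> complex mat) \<Rightarrow> bool" where
  "target_matrix At \<longleftrightarrow>
    (\<forall>s \<in> phase_space.
       At s \<in> carrier_mat 5 5 \<and>
       (\<forall>i < 5. \<forall>j \<le> i. At s $$ (i, j) = (if i = j then 1 else 0)) \<and>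
       (\<forall>i < 5. \<forall>j < 5. \<forall>x. (\<lambda>t. At (s(x := t)) $$ (i, j)) field_differentiable at (s x)) \<and>
       (\<forall>i < 5. \<forall>j < 5. \<forall>k < 5. \<forall>l < 5.
          poisson (\<lambda>p. At p $$ (i, j)) (\<lambda>p. Amat p $$ (k, l)) s = 0) \<and>
       Determinant.det (Amat s + transpose_mat (Amat s)) =
         Determinant.det (At s + transpose_mat (At s)))"

definition target_twist :: "(point \<Rightarrow> complex mat) \<Rightarrow> nat \<Rightarrow> point rel" where
  "target_twist At i = {(s, s'). s \<in> phase_space \<and> s' \<in> phase_space \<and>
     Amat s' = Amat s \<and>
     At s' = braid_factor i (- (At s $$ (i - 1, i))) * At s *
       transpose_mat (braid_factor i (- (At s $$ (i - 1, i))))}"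

text \<open>
  The new value of \<open>a\<^sub>t\<close> is determined by the constraint defining \<open>phase_space\<close>. That the new
  value of \<open>a\<^sub>2\<close> is nonzero restricts the domain to \<open>a\<^sub>t \<noteq> -1\<close>.
\<close>

definition G_B_twist :: "point rel" where
  "G_B_twist = {(s, s'). s \<in> phase_space \<and> s' \<in> phase_space \<and>
     s' A1 = 1 / s AT \<and>
     var A2 s' = var A2 s * (1 + var AT s) \<and>
     (\<forall>x. x \<notin> {A1, A2, AT} \<longrightarrow> s' x = s x)}"

lemma G45_form:
  fixes s :: point
  shows "\<exists>K a b c. \<forall>u v t. u \<noteq> 0 \<longrightarrow> v \<noteq> 0 \<longrightarrow>
    G45 (s(A1 := u, A2 := v, AT := t)) = K * u * (a * v\<^sup>2 + b + c / v\<^sup>2 + c / (v\<^sup>2 * u\<^sup>2))"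
proof -
  define i where "i = (\<lambda>x. inverse ((s x)\<^sup>2))"
  have *: "G45 (s(A1 := u, A2 := v, AT := t)) =
     (s E4 * s E3 * s E2 * s A3 * s A4 * s E1 * s D1 * s C1 * s B1) * u *
     ((1 + i E4 + i E4 * i E3 + i E4 * i E3 * i E2) * v\<^sup>2
      + (i E4 + i E4 * i E3 + i E4 * i E3 * i E2 + i E4 * i E3 * i A3 + i E4 * i E3 * i E2 * i A3
         + i E4 * i E3 * i E2 * i A3 * i A4
         + i E4 * i E3 * i E2 * i A3 * i A4 * i E1
         + i E4 * i E3 * i E2 * i A3 * i A4 * i E1 * i D1
         + i E4 * i E3 * i E2 * i A3 * i A4 * i E1 * i D1 * i C1
         + i E4 * i E3 * i E2 * i A3 * i A4 * i E1 * i D1 * i C1 * i B1)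
      + (i E4 * i E3 * i E2 * i A3 * i A4 * i E1 * i D1 * i C1 * i B1) / v\<^sup>2
      + (i E4 * i E3 * i E2 * i A3 * i A4 * i E1 * i D1 * i C1 * i B1) / (v\<^sup>2 * u\<^sup>2))"
    if nz: "u \<noteq> 0" "v \<noteq> 0" for u v t
  proof -
    define r q where "r = inverse (v\<^sup>2)" and "q = inverse (u\<^sup>2)"
    have v: "v\<^sup>2 * r = 1" using nz by (simp add: r_def)
    show ?thesis
      unfolding G45_def Let_def sqrt_monomial_def monomial_def var_def
      apply (simp add: divide_inverse)
      apply (simp only: i_def[symmetric] r_def[symmetric] q_def[symmetric] fun_cong[OF i_def, symmetric])
      apply (intro disjI2)
      subgoal
      proof -
        have "v * (v * (X + r * Y)) = X * v\<^sup>2 + Y" for X Y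
          using v by (simp add: algebra_simps power2_eq_square)
        from this[of "1 + i E4 + i E4 * i E3 + i E4 * i E3 * i E2"
          "(i E4 + i E4 * i E3 + i E4 * i E3 * i E2 + i E4 * i E3 * i A3 + i E4 * i E3 * i E2 * i A3
         + i E4 * i E3 * i E2 * i A3 * i A4
         + i E4 * i E3 * i E2 * i A3 * i A4 * i E1
         + i E4 * i E3 * i E2 * i A3 * i A4 * i E1 * i D1
         + i E4 * i E3 * i E2 * i A3 * i A4 * i E1 * i D1 * i C1
         + i E4 * i E3 * i E2 * i A3 * i A4 * i E1 * i D1 * i C1 * i B1)
      + (i E4 * i E3 * i E2 * i A3 * i A4 * i E1 * i D1 * i C1 * i B1) * r
      + (i E4 * i E3 * i E2 * i A3 * i A4 * i E1 * i D1 * i C1 * i B1) * (r * q)"]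
        show ?thesis by (simp add: algebra_simps)
      qed
      done
  qed
  show ?thesis
    by (intro exI allI impI) (rule *)
qed

lemma partial_G_B:
  assumes "s A1 \<noteq> 0" "s AT \<noteq> 0"
  shows "partial x G_B s =
    (if x = A1 then (s AT - s AT / (s A1)\<^sup>2 - 1 / ((s A1)\<^sup>2 * s AT)) / (2 * s A1)
     else if x = AT then (s A1 + 1 / s A1 - 1 / (s A1 * (s AT)\<^sup>2)) / (2 * s AT)
     else 0)"
proof -
  have GB: "G_B p = p A1 * p AT * (1 + 1 / (p A1)\<^sup>2 + 1 / ((p A1)\<^sup>2 * (p AT)\<^sup>2))" for p
    by (simp add: G_B_def angle_def sqrt_monomial_def monomial_def var_def numeral_eq_Suc)
  have "deriv (\<lambda>t. t * s AT * (1 + 1 / t\<^sup>2 + 1 / (t\<^sup>2 * (s AT)\<^sup>2))) (s A1) =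
      s AT - s AT / (s A1)\<^sup>2 - 1 / ((s A1)\<^sup>2 * s AT)"
    by (rule DERIV_imp_deriv)
      (rule derivative_eq_intros refl | use assms in \<open>simp add: field_simps power2_eq_square\<close>)+
  then have 1: "deriv (\<lambda>t. G_B (s(A1 := t))) (s A1) = s AT - s AT / (s A1)\<^sup>2 - 1 / ((s A1)\<^sup>2 * s AT)"
    by (simp only: GB fun_upd_apply vertex.distinct if_False if_True refl)
  have "deriv (\<lambda>t. s A1 * t * (1 + 1 / (s A1)\<^sup>2 + 1 / ((s A1)\<^sup>2 * t\<^sup>2))) (s AT) =
      s A1 + 1 / s A1 - 1 / (s A1 * (s AT)\<^sup>2)"
    by (rule DERIV_imp_deriv)
      (rule derivative_eq_intros refl | use assms in \<open>simp add: field_simps power2_eq_square\<close>)+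
  then have 2: "deriv (\<lambda>t. G_B (s(AT := t))) (s AT) = s A1 + 1 / s A1 - 1 / (s A1 * (s AT)\<^sup>2)"
    by (simp only: GB fun_upd_apply vertex.distinct if_False if_True refl)
  have 3: "deriv (\<lambda>t. G_B (s(x := t))) (s x) = 0" if "x \<noteq> A1" "x \<noteq> AT"
    unfolding GB using that by simp
  show ?thesis
    unfolding partial_def using 1 2 3 by simp
qed

lemma poisson_G_B:
  assumes nz: "\<forall>x. s x \<noteq> 0"
  shows "poisson G_B f s =
     partial A1 G_B s * var A1 s * (2 * var AT s * partial AT f s - var A2 s * partial A2 f s) +
     partial AT G_B s * var AT s * (var A2 s * partial A2 f s - 2 * var A1 s * partial A1 f s)"
proof -
  have A1: "eps A1 y = (if y = AT then 2 else if y = A2 then -1 else 0)" for y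
    by (cases y) (simp_all add: eps_def arrows_def)
  have AT: "eps AT y = (if y = A2 then 1 else if y = A1 then -2 else 0)" for y
    by (cases y) (simp_all add: eps_def arrows_def)
  define h where "h x y = partial x G_B s * partial y f s * (of_int (eps x y) * var x s * var y s)"
    for x y
  have "poisson G_B f s = (\<Sum>x\<in>UNIV. \<Sum>y\<in>UNIV. h x y)"
    by (simp add: poisson_def h_def)
  also have "\<dots> = (\<Sum>x\<in>{A1, AT}. \<Sum>y\<in>UNIV. h x y)"
    by (rule sum.mono_neutral_right) (auto simp: h_def partial_G_B nz)
  also have "\<dots> = (\<Sum>y\<in>UNIV. h A1 y) + (\<Sum>y\<in>UNIV. h AT y)"
    by simp
  also have "(\<Sum>y\<in>UNIV. h A1 y) = (\<Sum>y\<in>{A2, AT}. h A1 y)"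
    by (rule sum.mono_neutral_right) (auto simp: h_def A1)
  also have "(\<Sum>y\<in>UNIV. h AT y) = (\<Sum>y\<in>{A1, A2}. h AT y)"
    by (rule sum.mono_neutral_right) (auto simp: h_def AT)
  finally show ?thesis
    by (simp add: h_def A1 AT algebra_simps)
qed

text \<open>
  The rule for the action of the twist along \<open>G_B\<close> on the \<open>G\<^sub>i\<^sub>,\<^sub>i\<^sub>+\<^sub>1\<close>.
\<close>

lemma G_B_twist_G_adj:
  assumes "(s, s') \<in> G_B_twist"
  shows "k \<in> {1, 2, 3} \<Longrightarrow> G_adj k s' = G_adj k s"
    and "G_adj 4 s' = 1 / 2 * G_B s * G_adj 4 s + poisson G_B (G_adj 4) s"
proof -
  from assms have nz: "\<forall>x. s x \<noteq> 0" "\<forall>x. s' x \<noteq> 0" and s1: "s' A1 = 1 / s AT"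
    and s2: "(s' A2)\<^sup>2 = (s A2)\<^sup>2 * (1 + (s AT)\<^sup>2)"
    and eq: "\<And>x. x \<notin> {A1, A2, AT} \<Longrightarrow> s' x = s x"
    by (auto simp: G_B_twist_def phase_space_def var_def)
  show "G_adj k s' = G_adj k s" if "k \<in> {1, 2, 3}"
    using that by (auto simp: G_adj_def angle_def sqrt_monomial_def monomial_def var_def eq numeral_eq_Suc)
  obtain K a b c where G45: "\<And>u v t. u \<noteq> 0 \<Longrightarrow> v \<noteq> 0 \<Longrightarrow>
    G45 (s(A1 := u, A2 := v, AT := t)) = K * u * (a * v\<^sup>2 + b + c / v\<^sup>2 + c / (v\<^sup>2 * u\<^sup>2))"
    using G45_form[of s] by blast
  have upd: "s' = s(A1 := s' A1, A2 := s' A2, AT := s' AT)"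
    by (rule ext) (auto simp: eq)
  define x y z where "x = s A1" and "y = s A2" and "z = s AT"
  have nz3: "x \<noteq> 0" "y \<noteq> 0" "z \<noteq> 0" "1 + z\<^sup>2 \<noteq> 0"
    using nz s2 by (auto simp: x_def y_def z_def)
  have self: "s = s(A1 := x, A2 := y, AT := z)" by (simp add: x_def y_def z_def)
  have G0: "G45 s = K * x * (a * y\<^sup>2 + b + c / y\<^sup>2 + c / (y\<^sup>2 * x\<^sup>2))"
    by (subst self) (rule G45, use nz3 in auto)
  have "G45 s' = K * s' A1 * (a * (s' A2)\<^sup>2 + b + c / (s' A2)\<^sup>2 + c / ((s' A2)\<^sup>2 * (s' A1)\<^sup>2))"
    by (subst upd) (rule G45, use nz in auto)
  moreover have "c / (y\<^sup>2 * (1 + z\<^sup>2)) + c / (y\<^sup>2 * (1 + z\<^sup>2) * (1 / z)\<^sup>2) = c / y\<^sup>2"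
  proof -
    have "c / (y\<^sup>2 * (1 + z\<^sup>2)) + c / (y\<^sup>2 * (1 + z\<^sup>2) * (1 / z)\<^sup>2) =
        (c / y\<^sup>2) * ((1 + z\<^sup>2) / (1 + z\<^sup>2))"
      using nz3 by (simp add: divide_simps) (simp add: algebra_simps)
    then show ?thesis using nz3 by simp
  qed
  ultimately have G1: "G45 s' = K / z * (a * (y\<^sup>2 * (1 + z\<^sup>2)) + b + c / y\<^sup>2)"
    unfolding s1 s2 by (simp add: y_def z_def add.assoc)
  have ev: "eventually (\<lambda>t. t \<noteq> 0) (nhds w)" if "w \<noteq> 0" for w :: complex
    using that by (rule t1_space_nhds)
  have "deriv (\<lambda>t. G45 (s(A1 := t))) x = deriv (\<lambda>t. K * t * (a * y\<^sup>2 + b + c / y\<^sup>2 + c / (y\<^sup>2 * t\<^sup>2))) x"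
  proof (rule deriv_cong_ev)
    have "s(A1 := t) = s(A1 := t, A2 := y, AT := z)" for t by (rule ext) (simp add: y_def z_def)
    then show "\<forall>\<^sub>F t in nhds x. G45 (s(A1 := t)) = K * t * (a * y\<^sup>2 + b + c / y\<^sup>2 + c / (y\<^sup>2 * t\<^sup>2))"
      using eventually_mono[OF ev[OF nz3(1)]] G45 nz3 by (metis (mono_tags, lifting))
  qed simp
  also have "\<dots> = K * (a * y\<^sup>2 + b + c / y\<^sup>2 - c / (y\<^sup>2 * x\<^sup>2))"
    by (rule DERIV_imp_deriv)
      (rule derivative_eq_intros refl | use nz3 in \<open>simp add: field_simps power2_eq_square\<close>)+
  finally have p1: "partial A1 G45 s = K * (a * y\<^sup>2 + b + c / y\<^sup>2 - c / (y\<^sup>2 * x\<^sup>2)) / (2 * x)"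
    by (simp add: partial_def x_def)
  have "deriv (\<lambda>t. G45 (s(A2 := t))) y = deriv (\<lambda>t. K * x * (a * t\<^sup>2 + b + c / t\<^sup>2 + c / (t\<^sup>2 * x\<^sup>2))) y"
  proof (rule deriv_cong_ev)
    have "s(A2 := t) = s(A1 := x, A2 := t, AT := z)" for t by (rule ext) (simp add: x_def z_def)
    then show "\<forall>\<^sub>F t in nhds y. G45 (s(A2 := t)) = K * x * (a * t\<^sup>2 + b + c / t\<^sup>2 + c / (t\<^sup>2 * x\<^sup>2))"
      using eventually_mono[OF ev[OF nz3(2)]] G45 nz3 by (metis (mono_tags, lifting))
  qed simp
  also have "\<dots> = 2 * K * x * (a * y - c / y ^ 3 - c / (y ^ 3 * x\<^sup>2))"
    by (rule DERIV_imp_deriv)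
      (rule derivative_eq_intros refl | use nz3 in \<open>simp add: field_simps power2_eq_square power3_eq_cube\<close>)+
  finally have p2: "partial A2 G45 s = K * x * (a * y - c / y ^ 3 - c / (y ^ 3 * x\<^sup>2)) / y"
    using nz3 by (simp add: partial_def y_def)
  have "s(AT := t) = s(A1 := x, A2 := y, AT := t)" for t by (rule ext) (simp add: x_def y_def)
  then have "(\<lambda>t. G45 (s(AT := t))) = (\<lambda>t. K * x * (a * y\<^sup>2 + b + c / y\<^sup>2 + c / (y\<^sup>2 * x\<^sup>2)))"
    using G45 nz3 by (metis (no_types))
  then have p3: "partial AT G45 s = 0"
    by (simp add: partial_def)
  have GB: "G_B s = x * z * (1 + 1 / x\<^sup>2 + 1 / (x\<^sup>2 * z\<^sup>2))"
    by (simp add: G_B_def angle_def sqrt_monomial_def monomial_def var_def numeral_eq_Suc x_def z_def)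
  have q1: "partial A1 G_B s = (z - z / x\<^sup>2 - 1 / (x\<^sup>2 * z)) / (2 * x)"
    and q2: "partial AT G_B s = (x + 1 / x - 1 / (x * z\<^sup>2)) / (2 * z)"
    using nz by (simp_all add: partial_G_B x_def z_def)
  have adj4: "G_adj 4 = G45" by (simp add: G_adj_def)
  show "G_adj 4 s' = 1 / 2 * G_B s * G_adj 4 s + poisson G_B (G_adj 4) s"
    unfolding adj4 poisson_G_B[OF nz(1)] p1 p2 p3 q1 q2 GB G0 G1 var_def
      x_def[symmetric] y_def[symmetric] z_def[symmetric]
    using nz3(1-3) by (simp add: field_simps power2_eq_square power3_eq_cube)
qed

inductive_set braid_transformations :: "(point \<Rightarrow> complex mat) \<Rightarrow> point rel set"
  for At :: "point \<Rightarrow> complex mat" where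
  ident: "Id_on phase_space \<in> braid_transformations At"
| twist: "1 \<le> i \<Longrightarrow> i \<le> 4 \<Longrightarrow> twist i \<in> braid_transformations At"
| target_twist: "1 \<le> i \<Longrightarrow> i \<le> 4 \<Longrightarrow> target_twist At i \<in> braid_transformations At"
| G_B_twist: "G_B_twist \<in> braid_transformations At"
| inverse: "T \<in> braid_transformations At \<Longrightarrow> T\<inverse> \<in> braid_transformations At"
| compose: "T \<in> braid_transformations At \<Longrightarrow> U \<in> braid_transformations At \<Longrightarrow>
    T O U \<in> braid_transformations At"

end

theory Submission
  imports Defs
begin

text \<open>
  The twists along \<open>G\<^sub>i\<^sub>,\<^sub>i\<^sub>+\<^sub>1\<close> are congruences of \<open>\<A>\<close> by invertible matrices, and the target twists
  do not change \<open>\<A>\<close>, so only the twist along \<open>G\<^sub>B\<close> needs work. Write \<open>\<A> + \<A>\<^sup>T\<close>, up to signs, as a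
  symmetric \<open>4 \<times> 4\<close> block \<open>P\<close> not depending on \<open>a\<^sub>1, a\<^sub>2, a\<^sub>t\<close>, bordered by the column \<open>v\<close> of the
  \<open>G\<^sub>k\<^sub>5\<close>. In the cluster coordinates \<open>x\<^sub>0 = \<surd>a\<^sub>1\<close>, \<open>x\<^sub>1 = \<plusminus>1/\<surd>a\<^sub>t\<close>, the twist is the shift
  \<open>x\<^sub>n \<mapsto> x\<^sub>n\<^sub>+\<^sub>1\<close> along the recurrence \<open>x\<^sub>n\<^sub>+\<^sub>1 + x\<^sub>n\<^sub>-\<^sub>1 = g x\<^sub>n\<close>, whose coefficient
  \<open>g = (x\<^sub>0\<^sup>2 + x\<^sub>1\<^sup>2 + 1) / (x\<^sub>0 x\<^sub>1)\<close> is invariant, and \<open>v = \<alpha> x\<^sub>1 + \<beta> x\<^sub>0 + \<gamma> x\<^sub>-\<^sub>1\<close> with coefficients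
  free of \<open>a\<^sub>1, a\<^sub>2, a\<^sub>t\<close>. There is an explicit Laurent vector \<open>z\<close> with \<open>P z = \<alpha> - \<gamma>\<close>, \<open>z \<sqdot> \<alpha> = -1\<close>,
  \<open>z \<sqdot> \<beta> = 0\<close>, \<open>z \<sqdot> \<gamma> = 1\<close>. Subtracting \<open>x\<^sub>1 z\<close> times the first rows and columns from the last ones
  turns \<open>v\<close> into \<open>x\<^sub>0 (\<beta> + g \<gamma>)\<close> and the corner \<open>2\<close> into \<open>-2 x\<^sub>0\<^sup>2\<close>, so that
  \<open>det (\<A> + \<A>\<^sup>T)\<close> is \<open>x\<^sub>0\<^sup>2\<close> times a quantity invariant under the twist.
\<close>

section \<open>Laurent polynomials in the square roots of the quiver variables\<close>

definition lmono :: "(vertex \<Rightarrow> int) \<Rightarrow> point \<Rightarrow> complex" where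
  "lmono \<phi> s = (\<Prod>x\<in>UNIV. s x powi \<phi> x)"

lemma lmono_add:
  assumes "\<forall>x. s x \<noteq> 0"
  shows "lmono (\<lambda>x. \<phi> x + \<psi> x) s = lmono \<phi> s * lmono \<psi> s"
  using assms by (simp add: lmono_def power_int_add prod.distrib)

lemma has_field_derivative_lmono:
  assumes "\<forall>x. s x \<noteq> 0"
  shows "((\<lambda>t. lmono \<phi> (s(x := t))) has_field_derivative of_int (\<phi> x) * lmono \<phi> s / s x) (at (s x))"
proof -
  define r where "r = (\<Prod>y\<in>UNIV - {x}. s y powi \<phi> y)"
  have split: "lmono \<phi> (s(x := t)) = t powi \<phi> x * r" for t
    unfolding lmono_def r_def by (subst prod.remove[of _ x]) auto
  have "lmono \<phi> s = s x powi \<phi> x * r"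
    using split[of "s x"] by simp
  then show ?thesis
    unfolding split using assms
    by (auto intro!: derivative_eq_intros simp: power_int_diff)
qed

text \<open>
  Laurent polynomials are lists of terms, a term being an integer coefficient with the list of
  exponents of \<open>vertices\<close>. The variable \<open>a\<^sub>t\<close> is left out because it does not occur in \<open>\<A>\<close>.
\<close>

type_synonym lpoly = "(int \<times> int list) list"

definition vertices :: "vertex list" where
  "vertices = [A1, A2, A3, A4, B1, B2, B3, B4, C1, C2, C3, C4, D1, D2, D3, D4, E1, E2, E3, E4]"

fun expn :: "vertex list \<Rightarrow> int list \<Rightarrow> vertex \<Rightarrow> int" where
  "expn (v # vs) (k # e) x = (if x = v then k else expn vs e x)"
| "expn _ _ x = 0"

abbreviation lterm :: "int list \<Rightarrow> point \<Rightarrow> complex" where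
  "lterm e \<equiv> lmono (expn vertices e)"

definition lev :: "lpoly \<Rightarrow> point \<Rightarrow> complex" where
  "lev p s = (\<Sum>(c, e)\<leftarrow>p. of_int c * lterm e s)"

lemma lev_simps [simp]:
  "lev [] s = 0" "lev ((c, e) # p) s = of_int c * lterm e s + lev p s"
  "lev (p @ q) s = lev p s + lev q s"
  by (simp_all add: lev_def)

text \<open>Missing trailing exponents count as zero, so \<open>[]\<close> stands for the constant
  monomial.\<close>

fun padd :: "int list \<Rightarrow> int list \<Rightarrow> int list" where
  "padd [] f = f"
| "padd e [] = e"
| "padd (k # e) (l # f) = (k + l) # padd e f"

lemma expn_padd: "expn vs (padd e f) x = expn vs e x + expn vs f x"
  by (induction e f arbitrary: vs rule: padd.induct) (case_tac vs; simp)+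

lemma lterm_padd: "\<forall>x. s x \<noteq> 0 \<Longrightarrow> lterm (padd e f) s = lterm e s * lterm f s"
  using lmono_add[of s "expn vertices e" "expn vertices f"] by (simp add: expn_padd[abs_def])

fun dot :: "int list \<Rightarrow> int list \<Rightarrow> int" where
  "dot [] f = 0"
| "dot e [] = 0"
| "dot (k # e) (l # f) = k * l + dot e f"

lemma expn_outside: "x \<notin> set vs \<Longrightarrow> expn vs e x = 0"
  by (induction vs e x rule: expn.induct) auto

lemma dot_map: "distinct vs \<Longrightarrow> dot e (map h vs) = (\<Sum>x\<in>UNIV. expn vs e x * h x)"
proof (induction vs arbitrary: e)
  case Nil
  show ?case by (cases e) simp_all
next
  case (Cons v vs)
  show ?case
  proof (cases e)
    case (Cons k f)
    have "(\<Sum>x\<in>UNIV. expn (v # vs) e x * h x) =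
        (\<Sum>x\<in>UNIV. (if x = v then k * h x else 0) + expn vs f x * h x)"
      using Cons.prems by (intro sum.cong) (auto simp: Cons expn_outside)
    then show ?thesis
      using Cons.IH[of f] Cons.prems by (simp add: Cons sum.distrib)
  qed simp
qed

text \<open>
  Case distinctions are made by pattern matching in auxiliary functions instead of \<open>if\<close>: its
  congruence rule would make the simplifier traverse normalized lists again at every step.
\<close>

datatype comparison = Less | Equal | Greater

fun lex :: "int list \<Rightarrow> int list \<Rightarrow> comparison"
  and lex_step :: "bool \<Rightarrow> bool \<Rightarrow> int list \<Rightarrow> int list \<Rightarrow> comparison" where
  "lex [] [] = Equal"
| "lex [] f = Less"
| "lex e [] = Greater"
| "lex (k # e) (l # f) = lex_step (k = l) (k < l) e f"
| "lex_step True b e f = lex e f"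
| "lex_step False True e f = Less"
| "lex_step False False e f = Greater"

lemma lex_Equal:
  "lex e f = Equal \<Longrightarrow> e = f"
  "lex_step a b e f = Equal \<Longrightarrow> a \<and> e = f"
  by (induction e f and a b e f rule: lex_lex_step.induct) auto

definition lcons :: "int \<Rightarrow> int list \<Rightarrow> lpoly \<Rightarrow> lpoly" where
  "lcons c e p = (if c = 0 then p else (c, e) # p)"

lemma lev_lcons [simp]: "lev (lcons c e p) s = of_int c * lterm e s + lev p s"
  by (simp add: lcons_def)

text \<open>A merge: strictly \<open>lex\<close>-sorted inputs give a strictly sorted output without
  cancelled terms, which lets the polynomial identities below become equalities of lists.
  \<open>lev_ladd\<close> itself holds for unsorted lists.\<close>

function (sequential) ladd :: "lpoly \<Rightarrow> lpoly \<Rightarrow> lpoly"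
  and ladd_step :: "comparison \<Rightarrow> int \<Rightarrow> int list \<Rightarrow> lpoly \<Rightarrow> int \<Rightarrow> int list \<Rightarrow> lpoly \<Rightarrow> lpoly" where
  "ladd [] q = q"
| "ladd p [] = p"
| "ladd ((c, e) # p) ((d, f) # q) = ladd_step (lex e f) c e p d f q"
| "ladd_step Less c e p d f q = (c, e) # ladd p ((d, f) # q)"
| "ladd_step Equal c e p d f q = lcons (c + d) e (ladd p q)"
| "ladd_step Greater c e p d f q = (d, f) # ladd ((c, e) # p) q"
  by pat_completeness auto
termination
  by (relation "measure (\<lambda>x. case x of Inl (p, q) \<Rightarrow> 2 * (length p + length q)
    | Inr (_, _, _, p, _, _, q) \<Rightarrow> 2 * (length p + length q) + 3)") auto

lemma lev_ladd [simp]: "lev (ladd p q) s = lev p s + lev q s"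
proof -
  have "lev (ladd p q) s = lev p s + lev q s"
    and "(r = Equal \<Longrightarrow> e = f) \<Longrightarrow> lev (ladd_step r c e p' d f q') s = lev ((c, e) # p') s + lev ((d, f) # q') s"
    for r c e p' d f q'
    by (induction p q and r c e p' d f q' rule: ladd_ladd_step.induct)
      (auto simp: lex_Equal algebra_simps)
  then show ?thesis by blast
qed

fun lshift :: "int \<Rightarrow> int list \<Rightarrow> lpoly \<Rightarrow> lpoly" where
  "lshift d f [] = []"
| "lshift d f ((c, e) # p) = (c * d, padd e f) # lshift d f p"

lemma lev_lshift: "\<forall>x. s x \<noteq> 0 \<Longrightarrow> lev (lshift d f p) s = of_int d * lterm f s * lev p s"
  by (induction d f p rule: lshift.induct) (simp_all add: lterm_padd algebra_simps)

lemma lterm_Nil [simp]: "lterm [] s = 1"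
  by (simp add: lmono_def vertices_def)

lemma lev_smult: "\<forall>x. s x \<noteq> 0 \<Longrightarrow> lev (lshift d [] p) s = of_int d * lev p s"
  by (simp add: lev_lshift)

fun lmul :: "lpoly \<Rightarrow> lpoly \<Rightarrow> lpoly" where
  "lmul [] q = []"
| "lmul ((d, f) # p) q = ladd (lshift d f q) (lmul p q)"

lemma lev_lmul: "\<forall>x. s x \<noteq> 0 \<Longrightarrow> lev (lmul p q) s = lev p s * lev q s"
  by (induction p q rule: lmul.induct) (simp_all add: lev_lshift algebra_simps)

fun ldot :: "lpoly list \<Rightarrow> lpoly list \<Rightarrow> lpoly" where
  "ldot (p # ps) (q # qs) = ladd (lmul p q) (ldot ps qs)"
| "ldot _ _ = []"

section \<open>The Poisson bracket of Laurent polynomials\<close>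

definition eps_rows :: "int list list" where
  "eps_rows = map (\<lambda>x. map (eps x) vertices) vertices"

definition eps_mult :: "int list \<Rightarrow> int list" where
  "eps_mult f = map (dot f) eps_rows"

definition pairing :: "int list \<Rightarrow> int list \<Rightarrow> int" where
  "pairing e f = (\<Sum>x\<in>UNIV. \<Sum>y\<in>UNIV. eps x y * expn vertices e x * expn vertices f y)"

lemma distinct_vertices: "distinct vertices"
  by (simp add: vertices_def)

lemma dot_eps_mult: "dot e (eps_mult f) = pairing e f"
  by (simp add: eps_mult_def eps_rows_def comp_def dot_map distinct_vertices pairing_def
      sum_distrib_left mult_ac)

text \<open>
  For monomials \<open>m, n\<close> in the square roots with exponents \<open>e, f\<close>, the bracket \<open>{m, n}\<close> is
  \<open>pairing e f / 4 * m n\<close>; hence \<open>4 (m n / 2 + {m, n}) = (2 + pairing e f) m n\<close>.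
\<close>

fun ltwist :: "int list \<Rightarrow> int \<Rightarrow> int list \<Rightarrow> lpoly \<Rightarrow> lpoly" where
  "ltwist w d f [] = []"
| "ltwist w d f ((c, e) # p) = lcons (c * d * (2 + dot e w)) (padd e f) (ltwist w d f p)"

fun bracket4 :: "lpoly \<Rightarrow> lpoly \<Rightarrow> lpoly" where
  "bracket4 p [] = []"
| "bracket4 p ((d, f) # q) = ladd (ltwist (eps_mult f) d f p) (bracket4 p q)"

text \<open>The Euler operator for the root \<open>s x\<close>. In terms of it the bracket has
  constant coefficients \<open>eps\<close>; passing from a root to its square costs 1/2 in each
  argument, whence the factor 4.\<close>

definition euler :: "vertex \<Rightarrow> lpoly \<Rightarrow> point \<Rightarrow> complex" where
  "euler x p s = (\<Sum>(c, e)\<leftarrow>p. of_int c * of_int (expn vertices e x) * lterm e s)"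

definition eps_form :: "lpoly \<Rightarrow> lpoly \<Rightarrow> point \<Rightarrow> complex" where
  "eps_form p q s = (\<Sum>x\<in>UNIV. \<Sum>y\<in>UNIV. of_int (eps x y) * euler x p s * euler y q s)"

lemma lev_ltwist:
  assumes "\<forall>x. s x \<noteq> 0"
  shows "lev (ltwist (eps_mult f) d f p) s = 2 * lev p s * lev [(d, f)] s + eps_form p [(d, f)] s"
proof (induction p)
  case Nil
  show ?case by (simp add: eps_form_def euler_def)
next
  case (Cons t p)
  obtain c e where t: "t = (c, e)" by (cases t)
  have "eps_form (t # p) [(d, f)] s = eps_form [(c, e)] [(d, f)] s + eps_form p [(d, f)] s"
    by (simp add: t eps_form_def euler_def algebra_simps sum.distrib)
  moreover have "eps_form [(c, e)] [(d, f)] s =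
      of_int (pairing e f) * (of_int (c * d) * lterm e s * lterm f s)"
    by (simp add: eps_form_def euler_def pairing_def sum_distrib_right sum_distrib_left mult_ac)
  ultimately show ?case
    using Cons.IH assms by (simp add: t lterm_padd dot_eps_mult algebra_simps)
qed

lemma lev_bracket4:
  assumes "\<forall>x. s x \<noteq> 0"
  shows "lev (bracket4 p q) s = 2 * lev p s * lev q s + eps_form p q s"
proof (induction q)
  case Nil
  show ?case by (simp add: eps_form_def euler_def)
next
  case (Cons t q)
  obtain d f where t: "t = (d, f)" by (cases t)
  have "eps_form p (t # q) s = eps_form p [(d, f)] s + eps_form p q s"
    by (simp add: t eps_form_def euler_def algebra_simps sum.distrib)
  then show ?case
    using Cons.IH lev_ltwist[OF assms, of f d p] by (simp add: t algebra_simps)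
qed

text \<open>Agreement is required off the constraint too, since \<open>partial\<close> varies one
  coordinate alone and so leaves \<open>phase_space\<close>.\<close>

definition represents :: "lpoly \<Rightarrow> (point \<Rightarrow> complex) \<Rightarrow> bool" where
  "represents p f \<longleftrightarrow> (\<forall>s. (\<forall>x. s x \<noteq> 0) \<longrightarrow> f s = lev p s)"

lemma represents_partial:
  assumes "represents p f" "\<forall>x. s x \<noteq> 0"
  shows "partial x f s * var x s = euler x p s / 2"
proof -
  have "((\<lambda>t. lev p (s(x := t))) has_field_derivative euler x p s / s x) (at (s x))"
  proof (induction p)
    case (Cons t p)
    obtain c e where t: "t = (c, e)" by (cases t)
    have "((\<lambda>t. of_int c * lterm e (s(x := t)) + lev p (s(x := t))) has_field_derivative
       of_int c * (of_int (expn vertices e x) * lterm e s / s x) + euler x p s / s x) (at (s x))"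
      by (intro DERIV_add DERIV_cmult has_field_derivative_lmono assms(2) Cons.IH)
    then show ?case
      by (simp add: t euler_def add_divide_distrib mult.assoc del: fun_upd_apply)
  qed (simp add: euler_def)
  moreover have "\<forall>\<^sub>F t in nhds (s x). f (s(x := t)) = lev p (s(x := t))"
    using t1_space_nhds[of "s x" 0] assms unfolding represents_def
    by (auto elim!: eventually_mono)
  ultimately have "deriv (\<lambda>t. f (s(x := t))) (s x) = euler x p s / s x"
    by (metis DERIV_imp_deriv deriv_cong_ev)
  then show ?thesis
    using assms(2) by (simp add: partial_def var_def power2_eq_square)
qed

lemma represents_bracket4:
  assumes "represents p f" "represents q g" and nz: "\<forall>x. s x \<noteq> 0"
  shows "lev (bracket4 p q) s = 4 * (1 / 2 * f s * g s + poisson f g s)"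
proof -
  have "poisson f g s =
    (\<Sum>x\<in>UNIV. \<Sum>y\<in>UNIV. of_int (eps x y) * (partial x f s * var x s) * (partial y g s * var y s))"
    by (simp add: poisson_def mult_ac)
  also have "\<dots> = eps_form p q s / 4"
    using assms by (simp add: represents_partial eps_form_def sum_divide_distrib)
  finally have *: "poisson f g s = eps_form p q s / 4" .
  show ?thesis
    using assms by (simp add: * lev_bracket4 represents_def)
qed

definition quarter :: "lpoly \<Rightarrow> lpoly" where
  "quarter p = map (\<lambda>(c, e). (c div 4, e)) p"

lemma lev_quarter:
  "list_all (\<lambda>(c, e). 4 dvd c) p \<Longrightarrow> 4 * lev (quarter p) s = lev p s"
proof (induction p)
  case (Cons t p)
  obtain c e where t: "t = (c, e)" by (cases t)
  with Cons.prems obtain k where "c = 4 * k" by (auto elim: dvdE)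
  with Cons show ?case by (simp add: t quarter_def algebra_simps)
qed (simp add: quarter_def)

lemma represents_quarter_bracket4:
  assumes "represents p f" "represents q g" "list_all (\<lambda>(c, e). 4 dvd c) (bracket4 p q)"
  shows "represents (quarter (bracket4 p q)) (\<lambda>s. 1 / 2 * f s * g s + poisson f g s)"
proof -
  have "lev (quarter (bracket4 p q)) s = 1 / 2 * f s * g s + poisson f g s"
    if "\<forall>x. s x \<noteq> 0" for s
    using lev_quarter[OF assms(3), of s] represents_bracket4[OF assms(1,2) that]
    by (metis mult_left_cancel zero_neq_numeral)
  then show ?thesis by (simp add: represents_def)
qed

section \<open>Monomials and chain sums\<close>

definition expo :: "vertex list \<Rightarrow> vertex list \<Rightarrow> int list" where
  "expo xs ys = map (\<lambda>x. int (count_list xs x) - int (count_list ys x)) vertices"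

lemma expn_map: "expn vs (map h vs) x = (if x \<in> set vs then h x else 0)"
  by (induction vs) auto

lemma in_vertices: "x \<in> set vertices \<longleftrightarrow> x \<noteq> AT"
  by (cases x) (simp_all add: vertices_def)

lemma lmono_count_list: "lmono (\<lambda>x. int (count_list xs x)) s = sqrt_monomial xs s"
proof (induction xs)
  case (Cons v xs)
  have "lmono (\<lambda>x. int (count_list (v # xs) x)) s =
      (\<Prod>x\<in>UNIV. (if x = v then s x else 1) * s x ^ count_list xs x)"
    unfolding lmono_def by (intro prod.cong) auto
  also have "\<dots> = s v * lmono (\<lambda>x. int (count_list xs x)) s"
    by (simp add: prod.distrib lmono_def)
  finally show ?case
    using Cons.IH by (simp add: sqrt_monomial_def)
qed (simp add: lmono_def sqrt_monomial_def)

lemma lterm_expo: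
  assumes "\<forall>x. s x \<noteq> 0" "AT \<notin> set xs" "AT \<notin> set ys"
  shows "lterm (expo xs ys) s = sqrt_monomial xs s / sqrt_monomial ys s"
proof -
  have "expn vertices (expo xs ys) = (\<lambda>x. int (count_list xs x) - int (count_list ys x))"
    using assms(2,3) by (auto simp: expo_def expn_map in_vertices)
  then have "lterm (expo xs ys) s * sqrt_monomial ys s = sqrt_monomial xs s"
    using lmono_add[OF assms(1), of "\<lambda>x. int (count_list xs x) - int (count_list ys x)"
        "\<lambda>x. int (count_list ys x)"]
    by (simp add: lmono_count_list)
  moreover have "sqrt_monomial ys s \<noteq> 0"
    using assms(1) by (auto simp: sqrt_monomial_def prod_list_zero_iff)
  ultimately show ?thesis by (simp add: field_simps)
qed

text \<open>Exponents refer to square roots, but \<open>u\<close> lists quiver variables to be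
  divided out, so it counts twice.\<close>

fun lsum :: "int \<Rightarrow> vertex list \<Rightarrow> vertex list \<Rightarrow> vertex list list \<Rightarrow> lpoly" where
  "lsum c xs ys [] = []"
| "lsum c xs ys (u # us) = ladd [(c, expo xs (ys @ u @ u))] (lsum c xs ys us)"

lemma lev_lsum:
  assumes "\<forall>x. s x \<noteq> 0" "AT \<notin> set xs" "AT \<notin> set ys" "AT \<notin> \<Union> (set ` set us)"
  shows "lev (lsum c xs ys us) s =
    of_int c * (sqrt_monomial xs s / sqrt_monomial ys s) * (\<Sum>u\<leftarrow>us. 1 / monomial u s)"
  using assms(4)
proof (induction us)
  case (Cons u us)
  have "sqrt_monomial (u @ u) s = monomial u s"
    by (induction u) (simp_all add: sqrt_monomial_def monomial_def var_def power2_eq_square)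
  then have "sqrt_monomial (ys @ u @ u) s = sqrt_monomial ys s * monomial u s"
    by (simp add: sqrt_monomial_def)
  then show ?case
    using Cons assms(1-3) by (simp add: lterm_expo algebra_simps)
qed simp

definition chain :: "vertex list \<Rightarrow> lpoly" where
  "chain xs = lsum 1 xs [] (map (\<lambda>m. take m xs) [0..<Suc (length xs)])"

lemma represents_chain:
  assumes "AT \<notin> set xs"
  shows "represents (chain xs) (angle xs)"
proof -
  have "AT \<notin> \<Union> (set ` set (map (\<lambda>m. take m xs) [0..<Suc (length xs)]))"
    using assms by (auto dest: in_set_takeD)
  then show ?thesis
    using assms
    by (simp add: represents_def chain_def lev_lsum angle_def sum_list_distinct_conv_sum_set atLeast0LessThan
        lessThan_Suc_atMost comp_def sqrt_monomial_def del: upt_Suc)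
qed

text \<open>\<open>vertices\<close> begins with \<open>A1\<close>, \<open>A2\<close>, so the two
  leading exponents are the degrees in their roots.\<close>

lemma lev_homogeneous:
  assumes "\<forall>x. s x \<noteq> 0" "list_all (\<lambda>(c, e). take 2 e = [i, j]) p"
  shows "lev p s = s A1 powi i * s A2 powi j * lev p (s(A1 := 1, A2 := 1))"
  using assms(2)
proof (induction p)
  case (Cons t p)
  obtain c e where t: "t = (c, e)" by (cases t)
  with Cons.prems obtain f where e: "e = i # j # f"
    by (cases e; cases "tl e") auto
  have *: "lterm e s = s A1 powi i * s A2 powi j * (\<Prod>x\<in>UNIV - {A1} - {A2}. s x powi expn vertices e x)"
    if "s A1 \<noteq> 0" for s
    by (simp add: lmono_def prod.remove[of UNIV A1] prod.remove[of "UNIV - {A1}" A2] e vertices_def)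
  have "(\<Prod>x\<in>UNIV - {A1} - {A2}. (s(A1 := 1, A2 := 1)) x powi expn vertices e x) =
      (\<Prod>x\<in>UNIV - {A1} - {A2}. s x powi expn vertices e x)"
    by (intro prod.cong) auto
  then have "lterm e s = s A1 powi i * s A2 powi j * lterm e (s(A1 := 1, A2 := 1))"
    using *[of s] *[of "s(A1 := 1, A2 := 1)"] assms(1) by simp
  then show ?case
    using Cons by (simp add: t algebra_simps del: fun_upd_apply)
qed simp

lemma lev_cong:
  assumes "\<forall>x. x \<noteq> AT \<longrightarrow> s x = s' x"
  shows "lev p s = lev p s'"
proof -
  have "s x powi expn vertices e x = s' x powi expn vertices e x" for e x
    using assms by (cases "x = AT") (simp_all add: expn_outside in_vertices)
  then show ?thesis by (simp add: lev_def lmono_def)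
qed

section \<open>The entries of the matrix as explicit Laurent polynomials\<close>

definition "L12 = chain [B4, E2, D3, C4]"
definition "L23 = chain [C4, C3, B3, A4, E3, D4]"
definition "L34 = chain [D4, D3, D2, C2, B2, A3, E4]"
definition "stem = [E4, E3, E2, A2, A3, A4]"

text \<open>The parts of \<open>G\<^sub>4\<^sub>5\<close> of degree \<open>1\<close>, \<open>0\<close> and \<open>-1\<close> in \<open>a\<^sub>2\<close>.\<close>

definition "L45_plus = lsum 1 (stem @ [E1, D1, C1, B1, A2, A1]) [] [[], [E4], [E4, E3], [E4, E3, E2]]"
definition "L45_zero = lsum 1 (stem @ [E1, D1, C1, B1, A2, A1]) []
  [[E4, A2], [E4, E3, A2], [E4, E3, E2, A2], [E4, E3, A2, A3], [E4, E3, E2, A2, A3],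
   stem, stem @ [E1], stem @ [E1, D1], stem @ [E1, D1, C1], stem @ [E1, D1, C1, B1]]"
definition "L45_minus = lsum 1 (stem @ [E1, D1, C1, B1, A2, A1]) []
  [stem @ [E1, D1, C1, B1, A2], stem @ [E1, D1, C1, B1, A2, A1]]"
definition "L11 = [(2, expo [] [])]"
definition "L13 = quarter (bracket4 L12 L23)"
definition "L24 = quarter (bracket4 L23 L34)"
definition "L14 = quarter (bracket4 L13 L34)"

definition Gram :: "lpoly list list" where
  "Gram = [[L11, L12, L13, L14], [L12, L11, L23, L24], [L13, L23, L11, L34], [L14, L24, L34, L11]]"

text \<open>Each G_{k,5} is linear in G_{4,5}, so the three parts of G_{4,5} can be treated
  separately; the factor 4 keeps the coefficients integral.\<close>

definition last_column4 :: "lpoly \<Rightarrow> lpoly list" where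
  "last_column4 q = map (\<lambda>p. bracket4 p q) [L14, L24, L34] @ [lshift 4 [] q]"

text \<open>\<open>X_next\<close> is \<open>x\<^sub>1 = x1 s\<close>, and \<open>X_prev\<close> is \<open>x\<^sub>-\<^sub>1 = (x\<^sub>0\<^sup>2 + 1) / x\<^sub>1\<close>.\<close>

definition x1_vertices :: "vertex list" where
  "x1_vertices = [A1, A2, A2, A3, A3, A4, A4, B1, B2, B3, B4, C1, C2, C3, C4,
     D1, D2, D3, D4, E1, E2, E3, E4]"

definition "X_next = lsum 1 x1_vertices [] [[]]"
definition "X_prev = lsum 1 [A1, A1] x1_vertices [[], [A1]]"

text \<open>The vector \<gamma>, read off from \<open>last_column4 L45_minus\<close> by dividing by
  four times x_{-1}; its entries are single monomials.\<close>

definition gam :: "lpoly list" where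
  "gam = [lsum 1 [] [C4, D3, D4, E2, E3, E4] [[]],
     lsum 1 [B4] [D4, E3, E4] [[]],
     lsum 1 [A4, B3, B4, C3, C4] [E4] [[]],
     lsum 1 [A3, A4, B2, B3, B4, C2, C3, C4, D2, D3, D4] [] [[]]]"

text \<open>
  The vector \<open>z\<close>, found by solving \<open>P z = \<alpha> - \<gamma>\<close> numerically; the solution happens to consist of
  Laurent polynomials.
\<close>

definition kern :: "lpoly list" where
  "kern = [lsum (-1) [] [C4, D3, D4, E2, E3, E4] [[]],
     lsum 1 [] [B4, D4, E3, E4] [[], [E2], [E2, D3], [E2, D3, C4]],
     lsum (-1) [] [A4, B3, B4, C3, C4, E4] [[], [E3], [E3, E2], [E3, D4], [E3, E2, D4], [E3, E2, D4, D3]],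
     lsum 1 [] [A3, A4, B2, B3, B4, C2, C3, C4, D2, D3, D4] [[], [E4], [E4, E3], [E4, E3, E2]]]"

section \<open>Evaluation\<close>

schematic_goal eps_rows_eq: "eps_rows = ?r" by code_simp

lemmas lsum_eval = chain_def expo_def vertices_def stem_def x1_vertices_def upt_rec
lemmas bracket_eval = eps_mult_def eps_rows_eq lcons_def

\<comment> \<open>The unknown right-hand side becomes the normal form reached by simplification, so
  each polynomial is expanded only once.\<close>
schematic_goal L12_eq: "L12 = ?p" by (simp add: L12_def lsum_eval)
schematic_goal L23_eq: "L23 = ?p" by (simp add: L23_def lsum_eval)
schematic_goal L34_eq: "L34 = ?p" by (simp add: L34_def lsum_eval)
schematic_goal L45_plus_eq: "L45_plus = ?p" by (simp add: L45_plus_def lsum_eval)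
schematic_goal L45_zero_eq: "L45_zero = ?p" by (simp add: L45_zero_def lsum_eval)
schematic_goal L45_minus_eq: "L45_minus = ?p" by (simp add: L45_minus_def lsum_eval)
schematic_goal X_next_eq: "X_next = ?p" by (simp add: X_next_def lsum_eval)
schematic_goal X_prev_eq: "X_prev = ?p" by (simp add: X_prev_def lsum_eval)
schematic_goal gam_eq: "gam = ?p" by (simp add: gam_def lsum_eval)
schematic_goal kern_eq: "kern = ?p" by (simp add: kern_def lsum_eval)
schematic_goal one_eq: "expo [] [] = ?p" by (simp add: lsum_eval)

schematic_goal bracket4_L12_L23: "bracket4 L12 L23 = ?p"
  by (simp add: L12_eq L23_eq bracket_eval)
schematic_goal bracket4_L23_L34: "bracket4 L23 L34 = ?p"
  by (simp add: L23_eq L34_eq bracket_eval)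
schematic_goal L13_eq: "L13 = ?p" by (simp add: L13_def bracket4_L12_L23 quarter_def)
schematic_goal L24_eq: "L24 = ?p" by (simp add: L24_def bracket4_L23_L34 quarter_def)
schematic_goal bracket4_L13_L34: "bracket4 L13 L34 = ?p"
  by (simp add: L13_eq L34_eq bracket_eval)
schematic_goal L14_eq: "L14 = ?p" by (simp add: L14_def bracket4_L13_L34 quarter_def)

schematic_goal last_column4_plus: "last_column4 L45_plus = ?p"
  by (simp add: last_column4_def L14_eq L24_eq L34_eq L45_plus_eq bracket_eval)
schematic_goal last_column4_zero: "last_column4 L45_zero = ?p"
  by (simp add: last_column4_def L14_eq L24_eq L34_eq L45_zero_eq bracket_eval)
schematic_goal last_column4_minus: "last_column4 L45_minus = ?p"
  by (simp add: last_column4_def L14_eq L24_eq L34_eq L45_minus_eq bracket_eval)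

lemma dvd_brackets:
  "list_all (\<lambda>(c, e). 4 dvd c) (bracket4 L12 L23)"
  "list_all (\<lambda>(c, e). 4 dvd c) (bracket4 L23 L34)"
  "list_all (\<lambda>(c, e). 4 dvd c) (bracket4 L13 L34)"
  by (simp_all add: bracket4_L12_L23 bracket4_L23_L34 bracket4_L13_L34)

text \<open>Hence P and \<gamma> do not involve a_1 and a_2, and the middle part of the last column
  is x_0 times a \<beta> free of both.\<close>

lemma homogeneous:
  "list_all (list_all (list_all (\<lambda>(c, e). take 2 e = [0, 0]))) Gram"
  "list_all (list_all (\<lambda>(c, e). take 2 e = [0, 0])) gam"
  "list_all (list_all (\<lambda>(c, e). take 2 e = [1, 0])) (last_column4 L45_zero)"
  by (simp_all add: Gram_def L11_def one_eq L12_eq L13_eq L14_eq L23_eq L24_eq L34_eq gam_eq last_column4_zero)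

lemma minus_identity:
  "last_column4 L45_minus = map (\<lambda>g. lmul (lshift 4 [] X_prev) g) gam"
  by (simp add: last_column4_minus gam_eq X_prev_eq lcons_def)

lemma gamma_identity: "ldot kern gam = [(1, expo [] [])]"
  by (simp add: kern_eq gam_eq one_eq lcons_def)

text \<open>Since the left side is 4 x_1 \<alpha>, this says P z = \<alpha> - \<gamma>.\<close>

lemma plus_identity:
  "last_column4 L45_plus = map2 (\<lambda>r g. lmul (lshift 4 [] X_next) (ladd (ldot r kern) g)) Gram gam"
  by (simp add: last_column4_plus Gram_def L11_def one_eq L12_eq L13_eq L14_eq L23_eq L24_eq L34_eq gam_eq X_next_eq
      kern_eq lcons_def)

lemma kern_plus: "ldot kern (last_column4 L45_plus) = lshift (-4) [] X_next"
  by (simp add: kern_eq last_column4_plus X_next_eq lcons_def)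

lemma kern_zero: "ldot kern (last_column4 L45_zero) = []"
  by (simp add: kern_eq last_column4_zero lcons_def)

lemma sqrt_monomial_Nil [simp]: "sqrt_monomial [] s = 1"
  by (simp add: sqrt_monomial_def)

lemma represents_G:
  "represents L12 (G 1 2)" "represents L23 (G 2 3)" "represents L34 (G 3 4)"
  "represents L13 (G 1 3)" "represents L24 (G 2 4)" "represents L14 (G 1 4)"
proof -
  have G: "G 1 2 = G_adj 1" "G 2 3 = G_adj 2" "G 3 4 = G_adj 3"
    "G 1 3 = (\<lambda>s. 1 / 2 * G 1 2 s * G_adj 2 s + poisson (G 1 2) (G_adj 2) s)"
    "G 2 4 = (\<lambda>s. 1 / 2 * G 2 3 s * G_adj 3 s + poisson (G 2 3) (G_adj 3) s)"
    "G 1 4 = (\<lambda>s. 1 / 2 * G 1 3 s * G_adj 3 s + poisson (G 1 3) (G_adj 3) s)"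
    by (simp_all add: numeral_eq_Suc)
  have 1: "represents L12 (G_adj 1)" and 2: "represents L23 (G_adj 2)" and 3: "represents L34 (G_adj 3)"
    by (simp_all add: L12_def L23_def L34_def G_adj_def represents_chain)
  have 13: "represents L13 (G 1 3)"
    unfolding L13_def G by (rule represents_quarter_bracket4[OF 1 2 dvd_brackets(1)])
  show "represents L12 (G 1 2)" "represents L23 (G 2 3)" "represents L34 (G 3 4)"
    using 1 2 3 by (simp_all only: G)
  show "represents L13 (G 1 3)" by (rule 13)
  show "represents L24 (G 2 4)"
    unfolding L24_def G by (rule represents_quarter_bracket4[OF 2 3 dvd_brackets(2)])
  show "represents L14 (G 1 4)"
    unfolding L14_def G(6) by (rule represents_quarter_bracket4[OF 13 3 dvd_brackets(3)])
qed

lemma represents_G45: "represents (L45_plus @ L45_zero @ L45_minus) G45"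
  by (simp add: represents_def L45_plus_def L45_zero_def L45_minus_def stem_def lev_lsum G45_def
      Let_def distrib_left add.assoc del: lsum.simps)

lemma lev_bracket4_append: "lev (bracket4 p (q @ r)) s = lev (bracket4 p q) s + lev (bracket4 p r) s"
  by (induction p q rule: bracket4.induct) simp_all

lemma all_less_4: "(\<forall>k<4. Q k) \<longleftrightarrow> Q 0 \<and> Q 1 \<and> Q 2 \<and> Q (3::nat)"
  by (auto simp: numeral_eq_Suc less_Suc_eq)

lemma last_column4_nth:
  assumes nz: "\<forall>x. s x \<noteq> 0" and k: "k < 4"
  shows "4 * G (k + 1) 5 s = lev (last_column4 L45_plus ! k) s + lev (last_column4 L45_zero ! k) s +
    lev (last_column4 L45_minus ! k) s"
proof -
  have G: "G (Suc 0) 5 = (\<lambda>s. 1 / 2 * G 1 4 s * G45 s + poisson (G 1 4) G45 s)"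
    "G (Suc (Suc 0)) 5 = (\<lambda>s. 1 / 2 * G 2 4 s * G45 s + poisson (G 2 4) G45 s)"
    "G 3 5 = (\<lambda>s. 1 / 2 * G 3 4 s * G45 s + poisson (G 3 4) G45 s)"
    "G 4 5 = G45"
    using G.simps(2)[of 1 4] G.simps(2)[of 2 4] G.simps(2)[of 3 4] G.simps(2)[of 4 4]
    by (simp_all add: G_adj_def numeral_2_eq_2)
  have "4 * G 4 5 s = lev (lshift 4 [] L45_plus) s + lev (lshift 4 [] L45_zero) s +
      lev (lshift 4 [] L45_minus) s"
    using represents_G45 nz by (simp add: G lev_smult represents_def)
  moreover note represents_bracket4[OF represents_G(6) represents_G45 nz]
    represents_bracket4[OF represents_G(5) represents_G45 nz]
    represents_bracket4[OF represents_G(3) represents_G45 nz]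
  ultimately have "\<forall>k<4. 4 * G (k + 1) 5 s = lev (last_column4 L45_plus ! k) s +
      lev (last_column4 L45_zero ! k) s + lev (last_column4 L45_minus ! k) s"
    unfolding all_less_4 by (simp add: last_column4_def G(1-3) lev_bracket4_append add.assoc)
  then show ?thesis using k by blast
qed

section \<open>The bordered determinant\<close>

definition border :: "(nat \<Rightarrow> nat \<Rightarrow> complex) \<Rightarrow> (nat \<Rightarrow> complex) \<Rightarrow> complex \<Rightarrow> complex mat" where
  "border p v c = mat 5 5 (\<lambda>(i, j).
     if i < 4 \<and> j < 4 then p i j else if i < 4 then v i else if j < 4 then v j else c)"

lemma border_carrier [simp]: "border p v c \<in> carrier_mat 5 5"
  by (simp add: border_def)

text \<open>A congruence of \<open>K = border p u c\<close> by a lower triangular \<open>L\<close>,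
  whose first four rows carry the signs and whose last row is (x z, y). As \<open>K\<close> is
  symmetric, \<open>K\<close> times the transpose of \<open>L\<close> is the transpose of
  \<open>L * K\<close>, so \<open>mult\<close> serves both products.\<close>

lemma det_border:
  fixes p :: "nat \<Rightarrow> nat \<Rightarrow> complex"
  assumes sym: "\<And>i j. p i j = p j i"
  shows "Determinant.det (border (\<lambda>i j. (-1) ^ (i + j) * p i j)
      (\<lambda>i. (-1) ^ i * (x * (\<Sum>k<4. p i k * z k) + y * u i))
      (x\<^sup>2 * (\<Sum>k<4. z k * (\<Sum>l<4. p k l * z l)) + 2 * x * y * (\<Sum>k<4. z k * u k) + y\<^sup>2 * c)) =
    y\<^sup>2 * Determinant.det (border p u c)"
proof -
  define L where "L = mat 5 5 (\<lambda>(i, k).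
    if i < 4 then if k = i then (-1) ^ i else 0 else if k < 4 then x * z k else y)"
  have L: "L \<in> carrier_mat 5 5" by (simp add: L_def)
  have five: "{0..<5} = insert 4 {..<4::nat}" by auto
  have mult: "(L * M) $$ (i, j) =
      (if i < 4 then (-1) ^ i * M $$ (i, j) else x * (\<Sum>k<4. z k * M $$ (k, j)) + y * M $$ (4, j))"
    if "i < 5" "j < 5" "M \<in> carrier_mat 5 5" for M i j
  proof -
    have "(L * M) $$ (i, j) = (\<Sum>k<4. L $$ (i, k) * M $$ (k, j)) + L $$ (i, 4) * M $$ (4, j)"
      using that L by (simp add: scalar_prod_def five)
    moreover have "(\<Sum>k<4. L $$ (i, k) * M $$ (k, j)) = (-1) ^ i * M $$ (i, j)" if "i < 4"
    proof -
      have "(\<Sum>k<4. L $$ (i, k) * M $$ (k, j)) = (\<Sum>k<4. if k = i then (-1) ^ i * M $$ (k, j) else 0)"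
        using that by (intro sum.cong) (auto simp: L_def)
      then show ?thesis using that by simp
    qed
    ultimately show ?thesis
      using that by (auto simp: L_def sum_distrib_left mult.assoc)
  qed
  have "Determinant.det L = prod_list (diag_mat L)"
    using L by (intro det_lower_triangular[of 5]) (auto simp: L_def)
  \<comment> \<open>The signs 1, -1, 1, -1 on the diagonal multiply to 1.\<close>
  also have "\<dots> = y"
    by (simp add: diag_mat_def L_def numeral_eq_Suc)
  finally have det_L: "Determinant.det L = y" .
  define K where "K = border p u c"
  have K_nth: "K $$ (i, j) = (if i < 4 \<and> j < 4 then p i j else if i < 4 then u i else if j < 4 then u j else c)"
    if "i < 5" "j < 5" for i j
    using that by (simp add: K_def border_def)
  let ?v = "\<lambda>i. x * (\<Sum>k<4. p i k * z k) + y * u i"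
  let ?c = "x\<^sup>2 * (\<Sum>k<4. z k * (\<Sum>l<4. p k l * z l)) + 2 * x * y * (\<Sum>k<4. z k * u k) + y\<^sup>2 * c"
  have K: "K \<in> carrier_mat 5 5" by (simp add: K_def)
  have LK: "L * K \<in> carrier_mat 5 5" using L K by simp
  have KL: "(L * K)\<^sup>T \<in> carrier_mat 5 5" using LK by simp
  have "border (\<lambda>i j. (-1) ^ (i + j) * p i j) (\<lambda>i. (-1) ^ i * ?v i) ?c = L * (L * K)\<^sup>T"
  proof (rule eq_matI)
    fix i j assume "i < dim_row (L * (L * K)\<^sup>T)" "j < dim_col (L * (L * K)\<^sup>T)"
    then have ij: "i < 5" "j < 5" using L K by simp_all
    have KLT: "(L * K)\<^sup>T $$ (k, j) = (if j < 4 then (-1) ^ j * (if k < 4 then p k j else u j)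
        else if k < 4 then ?v k else x * (\<Sum>k<4. z k * u k) + y * c)" if "k < 5" for k
      using that ij LK mult[of j k K] K
      by (auto simp: K_nth sym mult.commute intro!: sum.cong)
    have "border (\<lambda>i j. (-1) ^ (i + j) * p i j) (\<lambda>i. (-1) ^ i * ?v i) ?c $$ (i, j) =
      (if i < 4 \<and> j < 4 then (-1) ^ (i + j) * p i j else if i < 4 then (-1) ^ i * ?v i
       else if j < 4 then (-1) ^ j * ?v j else ?c)"
      using ij by (simp add: border_def)
    also have "\<dots> = (L * (L * K)\<^sup>T) $$ (i, j)"
      unfolding mult[OF ij KL]
      using ij by (auto simp: KLT power_add sym sum_distrib_left sum_distrib_right
          sum.distrib power2_eq_square algebra_simps)
    finally show "border (\<lambda>i j. (-1) ^ (i + j) * p i j) (\<lambda>i. (-1) ^ i * ?v i) ?c $$ (i, j) =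
        (L * (L * K)\<^sup>T) $$ (i, j)" .
  qed (use L K in \<open>simp_all add: border_def\<close>)
  then show ?thesis
    using L K LK KL by (simp add: det_mult[OF L] det_transpose[OF LK] det_L power2_eq_square flip: K_def)
qed

lemma lev_ldot:
  assumes "\<forall>x. s x \<noteq> 0" "length ps = n" "length qs = n"
  shows "lev (ldot ps qs) s = (\<Sum>k<n. lev (ps ! k) s * lev (qs ! k) s)"
  using assms(2,3)
proof (induction ps qs arbitrary: n rule: ldot.induct)
  case (1 p ps q qs)
  then show ?case
    using assms(1) by (cases n) (auto simp: lev_lmul sum.lessThan_Suc_shift simp del: sum.lessThan_Suc)
qed auto

text \<open>By the constraint this is a square root of 1 / a_t on \<open>phase_space\<close>, yet it
  is a monomial in the other roots.\<close>

definition x1 :: "point \<Rightarrow> complex" where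
  "x1 s = sqrt_monomial x1_vertices s"

text \<open>Evaluating at \<open>base s\<close> strips the powers of \<open>a\<^sub>1, a\<^sub>2\<close> from homogeneous polynomials.\<close>

definition base :: "point \<Rightarrow> point" where
  "base s = s(A1 := 1, A2 := 1)"

definition reduced :: "point \<Rightarrow> complex \<Rightarrow> complex mat" where
  "reduced s g = border (\<lambda>i j. lev (Gram ! i ! j) s)
     (\<lambda>i. lev (last_column4 L45_zero ! i) s / 4 + lev (gam ! i) s * g) (-2)"

lemma lengths:
  "length Gram = 4" "length gam = 4" "length kern = 4" "length (last_column4 q) = 4"
  "i < 4 \<Longrightarrow> length (Gram ! i) = 4"
  by (simp_all add: Gram_def gam_def kern_def last_column4_def)
    (auto simp: Gram_def numeral_eq_Suc less_Suc_eq)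

lemma Amat_border:
  assumes nz: "\<forall>x. s x \<noteq> 0"
  shows "Amat s + transpose_mat (Amat s) =
    border (\<lambda>i j. (-1) ^ (i + j) * lev (Gram ! i ! j) s) (\<lambda>i. (-1) ^ i * G (i + 1) 5 s) 2"
proof -
  have one: "lev L11 s = 2" using nz by (simp add: L11_def lterm_expo)
  have G: "G (Suc 0) (Suc (Suc 0)) s = lev L12 s" "G (Suc (Suc 0)) 3 s = lev L23 s"
    "G 3 4 s = lev L34 s" "G (Suc 0) 3 s = lev L13 s" "G (Suc (Suc 0)) 4 s = lev L24 s"
    "G (Suc 0) 4 s = lev L14 s"
    using represents_G nz by (simp_all add: represents_def numeral_2_eq_2 del: G.simps)
  have all5: "(\<forall>i<5. Q i) \<longleftrightarrow> Q 0 \<and> Q 1 \<and> Q 2 \<and> Q 3 \<and> Q (4::nat)" for Q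
    by (auto simp: numeral_eq_Suc less_Suc_eq)
  have "\<forall>i<5. \<forall>j<5. (Amat s + transpose_mat (Amat s)) $$ (i, j) =
    border (\<lambda>i j. (-1) ^ (i + j) * lev (Gram ! i ! j) s) (\<lambda>i. (-1) ^ i * G (i + 1) 5 s) 2 $$ (i, j)"
    unfolding all5 using G by (simp add: Amat_def border_def Gram_def one del: G.simps)
  then show ?thesis
    by (intro eq_matI) (auto simp: Amat_def border_def)
qed

lemma det_Amat:
  assumes nz: "\<forall>x. s x \<noteq> 0"
  shows "Determinant.det (Amat s + transpose_mat (Amat s)) =
    (s A1)\<^sup>2 * Determinant.det (reduced (base s) (((s A1)\<^sup>2 + (x1 s)\<^sup>2 + 1) / (s A1 * x1 s)))"
proof -
  define y x where "y = s A1" and "x = x1 s"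
  define g where "g = (y\<^sup>2 + x\<^sup>2 + 1) / (y * x)"
  \<comment> \<open>\<open>det_border\<close> wants symmetry at all indices, while list lookup is
    known only below 4; \<open>min\<close> and \<open>max\<close> force it.\<close>
  define p where "p i j = lev (Gram ! min i j ! max i j) s" for i j
  define z c where "z i = lev (kern ! i) s" and "c i = lev (gam ! i) s" for i
  define u where "u i = lev (last_column4 L45_zero ! i) s / 4 / y + c i * g" for i
  have y: "y \<noteq> 0" using nz by (simp add: y_def)
  have x: "x \<noteq> 0" using nz by (auto simp: x_def x1_def sqrt_monomial_def prod_list_zero_iff)
  have next_prev: "lev X_next s = x" "lev X_prev s = (y\<^sup>2 + 1) / x"
    using nz y by (simp_all add: X_next_def X_prev_def lev_lsum x_def x1_def x1_vertices_def y_def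
        sqrt_monomial_def monomial_def var_def field_simps power2_eq_square del: lsum.simps)
  have Gram: "lev (Gram ! i ! j) s = p i j" if "i < 4" "j < 4" for i j
  proof -
    have "\<forall>i<4. \<forall>j<4. Gram ! i ! j = Gram ! min i j ! max i j"
      unfolding all_less_4 by (simp add: Gram_def)
    then have "Gram ! i ! j = Gram ! min i j ! max i j" using that by blast
    then show ?thesis unfolding p_def by (rule arg_cong)
  qed
  have sym: "p i j = p j i" for i j by (simp add: p_def min.commute max.commute)
  have plus: "lev (last_column4 L45_plus ! i) s = 4 * x * ((\<Sum>k<4. p i k * z k) + c i)" if "i < 4" for i
    using that nz unfolding plus_identity
    by (simp add: lengths lev_lmul lev_smult lev_ldot[where n = 4] next_prev Gram z_def c_def)
  have minus: "lev (last_column4 L45_minus ! i) s = 4 * ((y\<^sup>2 + 1) / x) * c i" if "i < 4" for i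
    using that nz unfolding minus_identity by (simp add: lengths lev_lmul lev_smult next_prev c_def)
  have zc: "(\<Sum>k<4. z k * c k) = 1"
    using nz lev_ldot[OF nz lengths(3,2)] by (simp add: gamma_identity z_def c_def lterm_expo)
  have zplus: "(\<Sum>k<4. z k * lev (last_column4 L45_plus ! k) s) = - 4 * x"
    using nz lev_ldot[OF nz lengths(3,4), of L45_plus]
    by (simp add: kern_plus z_def lev_smult next_prev)
  have zzero: "(\<Sum>k<4. z k * lev (last_column4 L45_zero ! k) s) = 0"
    using nz lev_ldot[OF nz lengths(3,4), of L45_zero] by (simp add: kern_zero z_def)
  have "- 4 * x = 4 * x * (\<Sum>k<4. z k * (\<Sum>l<4. p k l * z l)) + 4 * x * (\<Sum>k<4. z k * c k)"
    unfolding zplus[symmetric]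
    by (simp add: plus sum_distrib_left algebra_simps flip: sum.distrib)
  then have "4 * x * ((\<Sum>k<4. z k * (\<Sum>l<4. p k l * z l)) + 2) = 0"
    unfolding zc by (simp add: algebra_simps)
  then have zpz: "(\<Sum>k<4. z k * (\<Sum>l<4. p k l * z l)) = - 2"
    using x by (simp add: eq_neg_iff_add_eq_0)
  have "(\<Sum>k<4. z k * u k) = (\<Sum>k<4. z k * lev (last_column4 L45_zero ! k) s) / 4 / y + (\<Sum>k<4. z k * c k) * g"
    by (simp add: u_def algebra_simps sum.distrib sum_divide_distrib sum_distrib_left)
  then have zu: "(\<Sum>k<4. z k * u k) = g" by (simp add: zzero zc)
  \<comment> \<open>With \<open>y\<close> = x_0 this reads -2 x^2 + 2 (x^2 + y^2 + 1) - 2 y^2 =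
    2.\<close>
  have corner: "x\<^sup>2 * (\<Sum>k<4. z k * (\<Sum>l<4. p k l * z l)) + 2 * x * y * (\<Sum>k<4. z k * u k) + y\<^sup>2 * (-2) = 2"
    unfolding zpz zu g_def using x y by (simp add: field_simps power2_eq_square)
  \<comment> \<open>Insert \<alpha> = P z + \<gamma> into x_1 \<alpha> + x_0 \<beta> + x_{-1}
    \<gamma> and use x_1 + x_{-1} = g x_0.\<close>
  have column: "G (Suc i) 5 s = x * (\<Sum>k<4. p i k * z k) + y * u i" if "i < 4" for i
  proof -
    have "4 * G (Suc i) 5 s = 4 * (x * (\<Sum>k<4. p i k * z k) + y * u i)"
      unfolding Suc_eq_plus1 last_column4_nth[OF nz that] plus[OF that] minus[OF that] u_def g_def
      using x y by (simp add: field_simps power2_eq_square)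
    then show ?thesis by (metis mult_left_cancel zero_neq_numeral)
  qed
  have "Amat s + transpose_mat (Amat s) = border (\<lambda>i j. (-1) ^ (i + j) * p i j)
      (\<lambda>i. (-1) ^ i * (x * (\<Sum>k<4. p i k * z k) + y * u i))
      (x\<^sup>2 * (\<Sum>k<4. z k * (\<Sum>l<4. p k l * z l)) + 2 * x * y * (\<Sum>k<4. z k * u k) + y\<^sup>2 * (-2))"
    unfolding Amat_border[OF nz] corner
    by (rule eq_matI) (auto simp: border_def Gram column)
  then have "Determinant.det (Amat s + transpose_mat (Amat s)) = y\<^sup>2 * Determinant.det (border p u (-2))"
    by (simp only: det_border[of p, OF sym])
  also have "border p u (-2) = reduced (base s) g"
  proof -
    have "p i j = lev (Gram ! i ! j) (base s)" if "i < 4" "j < 4" for i j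
      using that lev_homogeneous[OF nz, of 0 0 "Gram ! i ! j"] homogeneous(1)
      by (simp add: Gram[symmetric] base_def list_all_length lengths del: fun_upd_apply)
    moreover have "u i = lev (last_column4 L45_zero ! i) (base s) / 4 + lev (gam ! i) (base s) * g"
      if "i < 4" for i
      using that lev_homogeneous[OF nz, of 0 0 "gam ! i"] homogeneous(2)
        lev_homogeneous[OF nz, of 1 0 "last_column4 L45_zero ! i"] homogeneous(3) y
      by (simp add: u_def c_def base_def list_all_length lengths y_def del: fun_upd_apply)
    ultimately show ?thesis
      unfolding reduced_def by (intro eq_matI) (auto simp: border_def)
  qed
  finally show ?thesis by (simp add: y_def x_def g_def)
qed

section \<open>Invariance under the transformations\<close>

lemma phase_space_x1: "s \<in> phase_space \<Longrightarrow> (s AT)\<^sup>2 * (x1 s)\<^sup>2 = 1"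
  by (simp add: phase_space_def x1_def x1_vertices_def sqrt_monomial_def var_def
      power_mult_distrib power2_eq_square mult_ac)

lemma G_B_twist_det:
  assumes "(s, s') \<in> G_B_twist"
  shows "Determinant.det (Amat s + transpose_mat (Amat s)) = 0 \<longleftrightarrow>
    Determinant.det (Amat s' + transpose_mat (Amat s')) = 0"
proof -
  from assms have nz: "\<forall>x. s x \<noteq> 0" "\<forall>x. s' x \<noteq> 0"
    and s: "s \<in> phase_space" and A1: "s' A1 = 1 / s AT"
    and A2: "(s' A2)\<^sup>2 = (s A2)\<^sup>2 * (1 + (s AT)\<^sup>2)"
    and eq: "\<And>x. x \<notin> {A1, A2, AT} \<Longrightarrow> s' x = s x"
    by (auto simp: G_B_twist_def phase_space_def var_def)
  define t y x where "t = s AT" and "y = s A1" and "x = x1 s"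
  have "1 + t\<^sup>2 \<noteq> 0" using A2 nz(2) by (auto simp: t_def)
  have tx: "t\<^sup>2 * x\<^sup>2 = 1" using phase_space_x1[OF s] by (simp add: t_def x_def)
  have nz': "t \<noteq> 0" "y \<noteq> 0" "x \<noteq> 0" using nz(1) tx by (auto simp: t_def y_def)
  \<comment> \<open>The twist fixes the root of a_2 only up to sign; it enters \<open>x1\<close>
    squared, so the sign does not matter.\<close>
  have x1_split: "x1 s = s A1 * (s A2)\<^sup>2 * sqrt_monomial (drop 3 x1_vertices) s" for s
    by (simp add: x1_def x1_vertices_def sqrt_monomial_def power2_eq_square)
  have "sqrt_monomial (drop 3 x1_vertices) s' = sqrt_monomial (drop 3 x1_vertices) s"
    by (simp add: x1_vertices_def sqrt_monomial_def eq)
  then have x': "x1 s' = x * (1 + t\<^sup>2) / (t * y)"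
    using nz' by (simp add: A1 A2 x_def x1_split t_def y_def field_simps)
  \<comment> \<open>Numerator and denominator both acquire the factor (1 + t^2) / (t^2 y^2), nonzero
    because the new a_2 is.\<close>
  have g: "((s' A1)\<^sup>2 + (x1 s')\<^sup>2 + 1) / (s' A1 * x1 s') = (y\<^sup>2 + x\<^sup>2 + 1) / (y * x)"
  proof -
    have "x\<^sup>2 * (1 + t\<^sup>2)\<^sup>2 = (1 + t\<^sup>2) * (x\<^sup>2 + t\<^sup>2 * x\<^sup>2)"
      by (simp add: algebra_simps power2_eq_square)
    then have "(x1 s')\<^sup>2 = (1 + t\<^sup>2) * (x\<^sup>2 + 1) / (t\<^sup>2 * y\<^sup>2)"
      by (simp add: x' power_divide power_mult_distrib tx)
    then have "(s' A1)\<^sup>2 + (x1 s')\<^sup>2 + 1 = (1 + t\<^sup>2) * (y\<^sup>2 + x\<^sup>2 + 1) / (t\<^sup>2 * y\<^sup>2)"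
      using nz' by (simp add: A1 t_def[symmetric] field_simps)
    moreover have "s' A1 * x1 s' = (1 + t\<^sup>2) * (y * x) / (t\<^sup>2 * y\<^sup>2)"
      using nz' by (simp add: A1 x' t_def[symmetric] field_simps power2_eq_square)
    ultimately show ?thesis
      using \<open>1 + t\<^sup>2 \<noteq> 0\<close> nz' by simp
  qed
  have "lev p (base s') = lev p (base s)" for p
    by (rule lev_cong) (auto simp: base_def eq)
  then have "reduced (base s') h = reduced (base s) h" for h
    by (simp add: reduced_def)
  then show ?thesis
    using nz det_Amat[OF nz(1)] det_Amat[OF nz(2)] g by (simp add: y_def x_def)
qed

lemma det_congruence:
  assumes "A \<in> carrier_mat n n" "B \<in> carrier_mat n n"
  shows "Determinant.det (B * A * B\<^sup>T + (B * A * B\<^sup>T)\<^sup>T) =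
    (Determinant.det B)\<^sup>2 * Determinant.det (A + A\<^sup>T :: complex mat)"
proof -
  have "B * A * B\<^sup>T + (B * A * B\<^sup>T)\<^sup>T = B * (A + A\<^sup>T) * B\<^sup>T"
    using assms
    by (simp add: transpose_mult[of _ n n _ n] add_mult_distrib_mat[of _ n n _ _ n]
        mult_add_distrib_mat[of _ n n _ n] assoc_mult_mat[of _ n n _ n _ n])
  then show ?thesis
    using assms by (simp add: det_mult[of _ n] det_transpose power2_eq_square)
qed

text \<open>The explicit inverse \<open>C\<close> has the block with rows (0, -1) and (1,
  g).\<close>

lemma det_braid_factor:
  assumes "1 \<le> i" "i \<le> 4"
  shows "Determinant.det (braid_factor i g) \<noteq> 0"
proof -
  define C where "C = mat 5 5 (\<lambda>(r, c).
     if (r, c) = (i - 1, i - 1) then 0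
     else if (r, c) = (i - 1, i) then -1
     else if (r, c) = (i, i - 1) then 1
     else if (r, c) = (i, i) then g
     else if r = c then 1 else 0)"
  have i: "i \<in> {1, 2, 3, 4}" using assms by auto
  have "braid_factor i g * C = 1\<^sub>m 5"
  proof (rule eq_matI)
    fix r c assume "r < dim_row (1\<^sub>m 5)" "c < dim_col (1\<^sub>m 5)"
    then have "r \<in> {0, 1, 2, 3, 4}" "c \<in> {0, 1, 2, 3, 4}" by auto
    then show "(braid_factor i g * C) $$ (r, c) = 1\<^sub>m 5 $$ (r, c)"
      using i by (auto simp: braid_factor_def C_def scalar_prod_def numeral_eq_Suc)
  qed (simp_all add: braid_factor_def C_def)
  then have "Determinant.det (braid_factor i g) * Determinant.det C = 1"
    using det_mult[of "braid_factor i g" 5 C] by (simp add: braid_factor_def C_def)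
  then show ?thesis by auto
qed

theorem lemma8p5:
  fixes At :: "point \<Rightarrow> complex mat"
  assumes "target_matrix At"
  shows "\<forall>T \<in> braid_transformations At. T `` degenerate_locus \<subseteq> degenerate_locus"
proof -
  define D where "D s = Determinant.det (Amat s + transpose_mat (Amat s))" for s
  \<comment> \<open>An equivalence rather than an implication, so that the induction passes through
    inverses.\<close>
  have "\<forall>(s, s') \<in> T. s \<in> phase_space \<and> s' \<in> phase_space \<and> (D s = 0 \<longleftrightarrow> D s' = 0)"
    if "T \<in> braid_transformations At" for T
    using that
  proof induction
    case (twist i)
    have "D s' = 0 \<longleftrightarrow> D s = 0" if "(s, s') \<in> twist i" for s s'
    proof -
      let ?B = "braid_factor i (G i (i + 1) s)"
      have "D s' = (Determinant.det ?B)\<^sup>2 * D s"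
        using that det_congruence[of "Amat s" 5 ?B]
        by (simp add: twist_def D_def Amat_def braid_factor_def)
      then show ?thesis
        using det_braid_factor[OF twist] by simp
    qed
    then show ?case by (auto simp: twist_def)
  next
    case G_B_twist
    then show ?case using G_B_twist_det by (auto simp: G_B_twist_def D_def)
  next
    case (compose T U)
    then show ?case by fast
  qed (auto simp: target_twist_def D_def)
  then show ?thesis
    by (fastforce simp: degenerate_locus_def D_def)
qed

end
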